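(* Let $p$ be a prime. If $G$ is a $p$-group, then each component of $\mathcal{G}^*(G)$ has exactly $p-1$ elements of order $p$.
   Context: A $p$-group is a finite group whose order is a power of $p$. The power graph $\mathcal{G}(G)$ of a group $G$ is the simple undirected graph with vertex set $G$ in which two distinct vertices $u,v$ are adjacent if $v=u^\alpha$ or $u=v^\alpha$ for some positive integer $\alpha$. The proper power graph $\mathcal{G}^*(G)$ is obtained from $\mathcal{G}(G)$ by deleting the identity element. A component of a graph is a maximal connected (non-null) subgraph; its elements are its vertices, and order means order in the group $G$. *)

theory Defs
  imports
    "HOL-Algebra.Multiplicative_Group"
    "HOL-Computational_Algebra.Primes"
    "Graph_Theory.Graph_Theory"
begin

text \<open>
  The trivial group is a \<open>p\<close>-group (exponent 0).
  Finiteness is stated explicitly although it follows from \<open>p \<noteq> 0\<close>.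
\<close>

definition p_group :: "nat \<Rightarrow> ('a, 'b) monoid_scheme \<Rightarrow> bool" where
  "p_group p G \<longleftrightarrow> group G \<and> finite (carrier G) \<and> (\<exists>n. Coset.order G = p ^ n)"

text \<open>
  Undirected graphs are encoded as in the locale \<open>graph\<close> of Graph_Theory: an edge between
  \<open>u\<close> and \<open>v\<close> is the pair of opposite arcs \<open>(u, v)\<close> and \<open>(v, u)\<close>.
\<close>

definition power_graph :: "('a, 'b) monoid_scheme \<Rightarrow> ('a, 'a \<times> 'a) pre_digraph" where
  "power_graph G = with_proj
     \<lparr> pverts = carrier G,
       parcs = {(u, v). u \<in> carrier G \<and> v \<in> carrier G \<and> u \<noteq> v \<and>
                  (\<exists>\<alpha>::nat. \<alpha> > 0 \<and> (v = u [^]\<^bsub>G\<^esub> \<alpha> \<or> u = v [^]\<^bsub>G\<^esub> \<alpha>))} \<rparr>"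

definition proper_power_graph :: "('a, 'b) monoid_scheme \<Rightarrow> ('a, 'a \<times> 'a) pre_digraph" where
  "proper_power_graph G = pre_digraph.del_vert (power_graph G) \<one>\<^bsub>G\<^esub>"

text \<open>
  Subgraphs in Graph_Theory may contain only one of two opposite arcs; requiring symmetry
  restricts them to the subgraphs of the undirected graph. The library's \<open>connected\<close>
  includes that the vertex set is non-empty.
\<close>

definition component :: "('a, 'e) pre_digraph \<Rightarrow> ('a, 'e) pre_digraph \<Rightarrow> bool" where
  "component \<Gamma> C \<longleftrightarrow>
     pre_digraph.max_subgraph \<Gamma> (\<lambda>H. symmetric H \<and> Digraph_Component.connected H) C"

lemma graph_power_graph:
  assumes "finite (carrier G)"
  shows "graph (power_graph G)"
proof -
  have "finite {(u, v). u \<in> carrier G \<and> v \<in> carrier G \<and> u \<noteq> v \<and>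
           (\<exists>\<alpha>::nat. \<alpha> > 0 \<and> (v = u [^]\<^bsub>G\<^esub> \<alpha> \<or> u = v [^]\<^bsub>G\<^esub> \<alpha>))}"
    by (rule finite_subset[of _ "carrier G \<times> carrier G"]) (use assms in auto)
  then show ?thesis
    using assms unfolding power_graph_def
    by unfold_locales (auto simp: arc_to_ends_def symmetric_def sym_def)
qed

lemma proper_power_graph_simps:
  "verts (proper_power_graph G) = carrier G - {\<one>\<^bsub>G\<^esub>}"
  "arcs (proper_power_graph G) =
     {(u, v). u \<in> carrier G - {\<one>\<^bsub>G\<^esub>} \<and> v \<in> carrier G - {\<one>\<^bsub>G\<^esub>} \<and> u \<noteq> v \<and>
        (\<exists>\<alpha>::nat. \<alpha> > 0 \<and> (v = u [^]\<^bsub>G\<^esub> \<alpha> \<or> u = v [^]\<^bsub>G\<^esub> \<alpha>))}"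
  "tail (proper_power_graph G) = fst"
  "head (proper_power_graph G) = snd"
  by (auto simp: proper_power_graph_def power_graph_def pre_digraph.del_vert_def)

lemma graph_proper_power_graph:
  assumes "finite (carrier G)"
  shows "graph (proper_power_graph G)"
proof -
  have "finite (arcs (proper_power_graph G))"
    by (rule finite_subset[of _ "carrier G \<times> carrier G"])
       (use assms in \<open>auto simp: proper_power_graph_simps\<close>)
  then show ?thesis
    using assms
    by unfold_locales
       (auto simp: proper_power_graph_simps arc_to_ends_def symmetric_def sym_def
         arcs_ends_def image_iff)
qed

end

theory Submission
  imports Defs
begin

text \<open>
  Fix \<open>x \<noteq> \<one>\<close> in the \<open>p\<close>-group. The order of \<open>x\<close> is a positive power of \<open>p\<close>, so the finite cyclic
  group of powers of \<open>x\<close> contains exactly one subgroup of order \<open>p\<close>, and hence exactly \<open>p - 1\<close>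
  elements of order \<open>p\<close>
  (\<open>card_powers_of_prime_order\<close>). The point of the proof is that this set of \<open>p - 1\<close> elements is
  an invariant of the component: if \<open>v\<close> is a power of \<open>u\<close>, then the set belonging to \<open>v\<close> is
  contained in the one belonging to \<open>u\<close>, and as both have \<open>p - 1\<close> elements, they agree
  (\<open>powers_of_prime_order_reachable\<close>).

  In the component of \<open>x\<close>, an element \<open>z\<close> of order \<open>p\<close> lies in its own set, which is the set of
  \<open>x\<close>. Conversely, every member of the set of \<open>x\<close> is a nontrivial power of \<open>x\<close>, so it is equal or
  adjacent to \<open>x\<close> and lies in the component. Thus the elements of order \<open>p\<close> in the component are
  precisely the \<open>p - 1\<close> ones that are powers of \<open>x\<close>. The passage from maximal connected subgraphs
  to reachability classes is \<open>verts_component_eq_scc_of\<close>.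
\<close>

text \<open>
  Natural exponents suffice to reach the whole cyclic subgroup generated by \<open>x\<close> when \<open>x\<close> has
  finite order; in that case these are the elements of order \<open>d\<close> of that subgroup.
\<close>

definition powers_of_order :: "('a, 'b) monoid_scheme \<Rightarrow> nat \<Rightarrow> 'a \<Rightarrow> 'a set" where
  "powers_of_order G d x = {z. (\<exists>k::nat. z = x [^]\<^bsub>G\<^esub> k) \<and> group.ord G z = d}"

text \<open>
  For \<open>p\<close> dividing the order of \<open>x\<close>, a power \<open>x\<^sup>k\<close> has an order dividing \<open>p\<close> iff \<open>k\<close> is a multiple of \<open>ord x div p\<close>. So these
  powers are the powers of the single element \<open>w = x\<^bsup>ord x div p\<^esup>\<close> of order \<open>p\<close>, and by primality all
  of them but \<open>\<one>\<close> have order exactly \<open>p\<close>.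
\<close>

lemma (in group) powers_of_prime_order_eq:
  assumes x: "x \<in> carrier G" and ord_x: "ord x \<noteq> 0" and p: "prime p" and dvd: "p dvd ord x"
  defines "w \<equiv> x [^] (ord x div p)"
  shows "ord w = p" and "powers_of_order G p x = (\<lambda>i::nat. w [^] i) ` {1..<p}"
proof -
  have p0: "p > 0" "p \<noteq> 1" using p by (auto simp: prime_gt_0_nat)
  obtain q where q: "ord x = p * q" using dvd by blast
  have q0: "q \<noteq> 0" using q ord_x by auto
  have wq: "w = x [^] q" by (simp add: w_def q p0)
  have w: "w \<in> carrier G" using x by (simp add: w_def)
  show ord_w: "ord w = p"
    using ord_pow[OF x, of q] q q0 by (simp add: wq)
  show "powers_of_order G p x = (\<lambda>i::nat. w [^] i) ` {1..<p}"
  proof (intro Set.set_eqI iffI)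
    fix z assume "z \<in> powers_of_order G p x"
    then obtain k :: nat where z: "z = x [^] k" and ord_z: "ord z = p"
      by (auto simp: powers_of_order_def)
    have "x [^] (k * p) = \<one>"
      using pow_eq_id[of z p] x ord_z by (simp add: z nat_pow_pow)
    then have "q dvd k" using x q p0 by (simp add: pow_eq_id mult.commute)
    then obtain m where "k = q * m" by blast
    then have zm: "z = w [^] m" using x by (simp add: z wq nat_pow_pow)
    have "w [^] m = w [^] (p * (m div p)) \<otimes> w [^] (m mod p)"
      using w by (simp add: nat_pow_mult)
    also have "w [^] (p * (m div p)) = \<one>"
      using w by (simp add: pow_eq_id ord_w)
    finally have zmod: "z = w [^] (m mod p)" using w by (simp add: zm)
    have "m mod p \<noteq> 0"
    proof
      assume "m mod p = 0"
      then have "z = \<one>" using zmod by simp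
      then show False using ord_z p0 by simp
    qed
    then show "z \<in> (\<lambda>i::nat. w [^] i) ` {1..<p}"
      using zmod p0 by (intro image_eqI[of _ _ "m mod p"]) auto
  next
    fix z assume "z \<in> (\<lambda>i::nat. w [^] i) ` {1..<p}"
    then obtain i where i: "0 < i" "i < p" and z: "z = w [^] i"
      by (metis Suc_le_eq One_nat_def atLeastLessThan_iff imageE)
    have zc: "z \<in> carrier G" using w z by simp
    have "z [^] p = \<one>" using w by (simp add: z nat_pow_pow pow_eq_id ord_w)
    then have "ord z dvd p" using zc by (simp add: pow_eq_id)
    moreover have "z \<noteq> \<one>"
      using w nat_dvd_not_less[OF i] by (simp add: z pow_eq_id ord_w)
    then have "ord z \<noteq> 1" using zc ord_eq_1 by blast
    ultimately have "ord z = p" using p by (auto simp: prime_nat_iff)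
    moreover have "z = x [^] (q * i)" using x by (simp add: z wq nat_pow_pow)
    ultimately show "z \<in> powers_of_order G p x"
      by (auto simp: powers_of_order_def)
  qed
qed

lemma (in group) card_powers_of_prime_order:
  assumes x: "x \<in> carrier G" and "ord x \<noteq> 0" and "prime p" and "p dvd ord x"
  shows "card (powers_of_order G p x) = p - 1"
proof -
  note eq = powers_of_prime_order_eq[OF assms]
  have "inj_on (\<lambda>i::nat. (x [^] (ord x div p)) [^] i) {1..<p}"
    by (rule inj_on_subset[OF ord_inj']) (use x eq(1) in auto)
  then show ?thesis unfolding eq(2) by (simp add: card_image)
qed

text \<open>
  Connected symmetric subgraphs are strongly connected, and so lie inside a strongly connected
  component of a symmetric graph. That component is an induced subgraph, hence itself symmetric
  and connected, so a maximal such subgraph is all of it.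
\<close>

lemma verts_component_eq_scc_of:
  assumes \<Gamma>: "sym_digraph \<Gamma>" and C: "component \<Gamma> C" and u: "u \<in> verts C"
  shows "verts C = pre_digraph.scc_of \<Gamma> u"
proof -
  interpret sym_digraph \<Gamma> by (rule \<Gamma>)
  have sub: "subgraph C \<Gamma>" and symC: "symmetric C" and conn: "Digraph_Component.connected C"
    and max: "\<And>H. subgraph C H \<Longrightarrow> subgraph H \<Gamma> \<Longrightarrow> symmetric H \<Longrightarrow>
      Digraph_Component.connected H \<Longrightarrow> H = C"
    using C by (auto simp: component_def max_subgraph_def)
  interpret C: wf_digraph C using sub by blast
  have scC: "u \<rightarrow>\<^sup>*\<^bsub>C\<^esub> v" if "u \<in> verts C" "v \<in> verts C" for u v
    using conn that C.reachable_mk_symmetric_eq[OF symC]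
    by (auto simp: Digraph_Component.connected_def strongly_connected_def)
  have subset: "verts C \<subseteq> scc_of u"
    using scC u by (auto simp: scc_of_def intro: reachable_mono[OF _ sub])
  have "u \<in> verts \<Gamma>" using u sub by auto
  then have "scc_of u \<in> verts ` sccs"
    using scc_of_in_sccs_verts sccs_verts_conv by simp
  then obtain H where H: "H \<in> sccs" and vH: "verts H = scc_of u" by auto
  have ind: "induced_subgraph H \<Gamma>" and scH: "strongly_connected H"
    using H by auto
  have subH: "subgraph H \<Gamma>" using ind by auto
  interpret H: wf_digraph H using subH by blast
  have ends: "tail H = tail \<Gamma>" "head H = head \<Gamma>" "tail C = tail \<Gamma>" "head C = head \<Gamma>"
    using sub subH by (auto simp: subgraph_def compatible_def)
  have arcsH: "arcs H = {e \<in> arcs \<Gamma>. tail \<Gamma> e \<in> verts H \<and> head \<Gamma> e \<in> verts H}"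
    using ind by auto
  have symH: "symmetric H"
    using sym_arcs unfolding symmetric_conv arcsH ends by (fastforce simp: arcsH)
  have "arcs C \<subseteq> arcs H"
    using sub subset C.wellformed unfolding arcsH vH ends by blast
  then have "subgraph C H"
    using subset ends vH C.wf_digraph_axioms H.wf_digraph_axioms
    by (auto simp: subgraph_def compatible_def)
  moreover have "Digraph_Component.connected H"
    using scH H.reachable_mk_symmetric_eq[OF symH]
    by (auto simp: Digraph_Component.connected_def strongly_connected_def)
  ultimately have "H = C" using max subH symH by blast
  then show ?thesis using vH by simp
qed

lemma p_group_prime_dvd_ord:
  assumes p: "prime p" and pG: "p_group p G" and x: "x \<in> carrier G" "x \<noteq> \<one>\<^bsub>G\<^esub>"
  shows "p dvd group.ord G x"
proof -
  interpret group G using pG by (simp add: p_group_def)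
  obtain n where "Coset.order G = p ^ n" using pG by (auto simp: p_group_def)
  then obtain k where "ord x = p ^ k"
    using ord_dvd_group_order[OF x(1)] divides_primepow_nat[OF p] by auto
  moreover have "ord x \<noteq> 1" using x ord_eq_1 by simp
  ultimately show ?thesis by (cases k) auto
qed

text \<open>
  Along an edge one endpoint is a power of the other, so one of the two sets contains the other;
  having the same cardinality \<open>p - 1\<close>, they coincide.
\<close>

lemma powers_of_prime_order_reachable:
  assumes p: "prime p" and pG: "p_group p G" and reach: "u \<rightarrow>\<^sup>*\<^bsub>proper_power_graph G\<^esub> v"
  shows "powers_of_order G p u = powers_of_order G p v"
proof -
  interpret group G using pG by (simp add: p_group_def)
  have fin: "finite (carrier G)" using pG by (simp add: p_group_def)
  interpret \<Gamma>: graph "proper_power_graph G" by (rule graph_proper_power_graph[OF fin])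
  have power: "powers_of_order G p v = powers_of_order G p u"
    if u: "u \<in> carrier G - {\<one>\<^bsub>G\<^esub>}" and v: "v \<in> carrier G - {\<one>\<^bsub>G\<^esub>}" and eq: "v = u [^]\<^bsub>G\<^esub> (a::nat)" for u v a
  proof (rule card_subset_eq)
    have card: "card (powers_of_order G p x) = p - 1" if "x \<in> carrier G - {\<one>\<^bsub>G\<^esub>}" for x
      using that ord_ge_1[OF fin, of x] p_group_prime_dvd_ord[OF p pG, of x]
      by (intro card_powers_of_prime_order p) auto
    show "finite (powers_of_order G p u)"
      by (rule finite_subset[OF _ fin]) (use u in \<open>auto simp: powers_of_order_def\<close>)
    show "powers_of_order G p v \<subseteq> powers_of_order G p u"
      using u by (auto simp: powers_of_order_def eq nat_pow_pow)
    show "card (powers_of_order G p v) = card (powers_of_order G p u)"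
      using card u v by simp
  qed
  have edge: "powers_of_order G p u = powers_of_order G p v"
    if "u \<rightarrow>\<^bsub>proper_power_graph G\<^esub> v" for u v
    using that power by (auto simp: arcs_ends_conv proper_power_graph_simps)
  from reach show ?thesis
    by (induction rule: \<Gamma>.reachable_induct) (use edge in auto)
qed

theorem proposition3p2:
  fixes G :: "('a, 'b) monoid_scheme" and p :: nat and C :: "('a, 'a \<times> 'a) pre_digraph"
  assumes "prime p"
    and "p_group p G"
    and "component (proper_power_graph G) C"
  shows "card {x \<in> verts C. group.ord G x = p} = p - 1"
proof -
  interpret group G using assms(2) by (simp add: p_group_def)
  have fin: "finite (carrier G)" using assms(2) by (simp add: p_group_def)
  interpret \<Gamma>: graph "proper_power_graph G" by (rule graph_proper_power_graph[OF fin])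
  have sub: "subgraph C (proper_power_graph G)" and "Digraph_Component.connected C"
    using assms(3) by (auto simp: component_def \<Gamma>.max_subgraph_def)
  then obtain x where x: "x \<in> verts C"
    by (auto simp: Digraph_Component.connected_def strongly_connected_def)
  then have "x \<in> verts (proper_power_graph G)" using sub by auto
  then have xG: "x \<in> carrier G" "x \<noteq> \<one>\<^bsub>G\<^esub>" by (auto simp: proper_power_graph_simps)
  have C: "verts C = \<Gamma>.scc_of x"
    by (rule verts_component_eq_scc_of[OF _ assms(3) x]) unfold_locales
  have "{z \<in> verts C. ord z = p} = powers_of_order G p x"
  proof (intro Set.set_eqI iffI)
    fix z assume z: "z \<in> {z \<in> verts C. ord z = p}"
    then have "z \<in> verts (proper_power_graph G)" using sub by auto
    then have zG: "z \<in> carrier G" by (simp add: proper_power_graph_simps)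
    have "x \<rightarrow>\<^sup>*\<^bsub>proper_power_graph G\<^esub> z" using z C by (simp add: \<Gamma>.scc_of_def)
    then have "powers_of_order G p x = powers_of_order G p z"
      by (rule powers_of_prime_order_reachable[OF assms(1,2)])
    moreover have "z = z [^]\<^bsub>G\<^esub> (1::nat)" using zG by simp
    ultimately show "z \<in> powers_of_order G p x"
      using z unfolding powers_of_order_def by blast
  next
    fix z assume "z \<in> powers_of_order G p x"
    then obtain k :: nat where k: "z = x [^]\<^bsub>G\<^esub> k" and ord_z: "ord z = p"
      by (auto simp: powers_of_order_def)
    have z: "z \<in> carrier G" using xG k by simp
    have z1: "z \<noteq> \<one>\<^bsub>G\<^esub>" using ord_z assms(1) by auto
    then have k0: "k > 0" using k by (cases k) auto
    have "x \<rightarrow>\<^sup>*\<^bsub>proper_power_graph G\<^esub> z"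
    proof (cases "z = x")
      case True
      then show ?thesis using \<open>x \<in> verts (proper_power_graph G)\<close> by simp
    next
      case False
      then have "(x, z) \<in> arcs (proper_power_graph G)"
        using xG z z1 k k0 by (auto simp: proper_power_graph_simps)
      then have "x \<rightarrow>\<^bsub>proper_power_graph G\<^esub> z"
        by (force simp: arcs_ends_conv proper_power_graph_simps(3,4))
      then show ?thesis by simp
    qed
    then have "z \<in> \<Gamma>.scc_of x" by (rule \<Gamma>.scc_ofI_reachable')
    then show "z \<in> {z \<in> verts C. ord z = p}" using C ord_z by simp
  qed
  moreover have "card (powers_of_order G p x) = p - 1"
    using xG ord_ge_1[OF fin xG(1)] p_group_prime_dvd_ord[OF assms(1,2) xG]
    by (intro card_powers_of_prime_order assms(1)) auto
  ultimately show ?thesis by simp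
qed

end
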